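(* Let $G=(V,E)$ be a finite $\Delta$-regular graph, let $\mathbf A_G$ be its adjacency matrix, set $\lambda^\star=-\lambda_{\min}(\mathbf A_G)$, and let $\lambda>0$. Suppose that $$1+\lambda^{-1}\ge\lambda^\star .$$ Then $$V_G(\lambda)\;\le\;\frac{\lambda}{1+(\Delta+1)\lambda}.$$
   Context: The hardcore measure on $G$ with fugacity $\lambda>0$ is the probability measure $\mu_{G,\lambda}(I)\propto\lambda^{|I|}$ on the collection of independent sets $I$ of $G$. The variance fraction is $V_G(\lambda)=\frac1{|V|}\mathrm{Var}[|I|]$ with $I\sim\mu_{G,\lambda}$. $\lambda_{\min}(\mathbf A_G)$ is the smallest eigenvalue of $\mathbf A_G$. *)

theory Defs
  imports "HOL-Analysis.Analysis" "HOL-Probability.Probability"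
begin

text \<open>A finite simple graph is given by its adjacency relation on a finite type of vertices;
  as types are inhabited, the vertex set is nonempty.\<close>

definition simple_graph :: "('v::finite \<Rightarrow> 'v \<Rightarrow> bool) \<Rightarrow> bool" where
  "simple_graph E \<longleftrightarrow> symp E \<and> irreflp E"

definition regular_graph :: "nat \<Rightarrow> ('v::finite \<Rightarrow> 'v \<Rightarrow> bool) \<Rightarrow> bool" where
  "regular_graph d E \<longleftrightarrow> (\<forall>v. card {w. E v w} = d)"

definition adjacency_matrix :: "('v::finite \<Rightarrow> 'v \<Rightarrow> bool) \<Rightarrow> real ^ 'v ^ 'v" where
  "adjacency_matrix E = (\<chi> u v. if E u v then 1 else 0)"

definition is_eigenvalue :: "real ^ 'n ^ 'n \<Rightarrow> real \<Rightarrow> bool" where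
  "is_eigenvalue A k \<longleftrightarrow> (\<exists>x. x \<noteq> 0 \<and> A *v x = k *\<^sub>R x)"

text \<open>Meaningful when the set of real eigenvalues is nonempty, as for the symmetric matrix of a
  simple graph.\<close>

definition min_eigenvalue :: "real ^ 'n ^ 'n \<Rightarrow> real" where
  "min_eigenvalue A = Min {k. is_eigenvalue A k}"

definition independent_sets :: "('v::finite \<Rightarrow> 'v \<Rightarrow> bool) \<Rightarrow> 'v set set" where
  "independent_sets E = {I. \<forall>u\<in>I. \<forall>v\<in>I. \<not> E u v}"

definition partition_function :: "('v::finite \<Rightarrow> 'v \<Rightarrow> bool) \<Rightarrow> real \<Rightarrow> real" where
  "partition_function E fug = (\<Sum>I\<in>independent_sets E. fug ^ card I)"

text \<open>For \<open>fug > 0\<close> the given weights are a probability mass function, so that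
  \<^const>\<open>embed_pmf\<close> is meaningful; see \<open>pmf_hardcore\<close> below.\<close>

definition hardcore :: "('v::finite \<Rightarrow> 'v \<Rightarrow> bool) \<Rightarrow> real \<Rightarrow> 'v set pmf" where
  "hardcore E fug = embed_pmf (\<lambda>I. if I \<in> independent_sets E
     then fug ^ card I / partition_function E fug else 0)"

definition variance_fraction :: "('v::finite \<Rightarrow> 'v \<Rightarrow> bool) \<Rightarrow> real \<Rightarrow> real" where
  "variance_fraction E fug =
     measure_pmf.variance (hardcore E fug) (\<lambda>I. real (card I)) / real CARD('v)"

lemma partition_function_pos:
  assumes "fug > 0"
  shows "partition_function E fug > 0"
proof -
  have "{} \<in> independent_sets E"
    by (simp add: independent_sets_def)
  then show ?thesis
    unfolding partition_function_def using assms by (intro sum_pos) auto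
qed

lemma pmf_hardcore:
  assumes "fug > 0"
  shows "pmf (hardcore E fug) I = (if I \<in> independent_sets E
     then fug ^ card I / partition_function E fug else 0)"
proof -
  let ?f = "\<lambda>I. if I \<in> independent_sets E then fug ^ card I / partition_function E fug else 0"
  note Z = partition_function_pos[OF assms, of E]
  have nonneg: "0 \<le> ?f J" for J
    using Z assms by auto
  have "(\<Sum>J\<in>UNIV. ?f J) = (\<Sum>J\<in>independent_sets E. fug ^ card J / partition_function E fug)"
    by (simp add: sum.If_cases)
  also have "\<dots> = 1"
    using Z by (simp add: partition_function_def flip: sum_divide_distrib)
  finally have "(\<integral>\<^sup>+J. ennreal (?f J) \<partial>count_space UNIV) = 1"
    using nonneg by (simp add: nn_integral_count_space_finite sum_ennreal del: ennreal_1 flip: ennreal_1)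
  then show ?thesis
    unfolding hardcore_def using nonneg by (subst pmf_embed_pmf) auto
qed

end

theory Submission
  imports Defs
begin

text \<open>Let \<open>L\<close> be the generator of the Glauber dynamics that adds each admissible vertex at rate \<open>1\<close>
  and removes each occupied vertex at rate \<open>1 / \<lambda>\<close>; it is reversible for the hard-core measure. Write
  \<open>D\<^sub>v h (I) = h (I \<union> {v}) - h I\<close> and \<open>p\<^sub>v = D\<^sub>v h\<close> where \<open>v\<close> can be added, \<open>p\<^sub>v = 0\<close> elsewhere.
  Commuting \<open>D\<^sub>v\<close> with \<open>L\<close> gives a Bochner inequality \<open>E (p\<^sup>T M p) \<le> E (L h)\<^sup>2\<close> with
  \<open>M = A + (1 + 1 / \<lambda>) Id\<close>, which is positive semidefinite by the hypothesis on \<open>\<lambda>\<close>. For the solution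
  \<open>h\<close> of \<open>L h = E X - X\<close>, where \<open>X = |I|\<close>, both \<open>E (L h)\<^sup>2\<close> and \<open>E (\<Sum>\<^sub>v p\<^sub>v)\<close> equal \<open>Var X\<close>. The
  all-ones vector is an eigenvector of \<open>M\<close> with eigenvalue \<open>m = \<Delta> + 1 + 1 / \<lambda>\<close>, so averaging
  \<open>0 \<le> (1 - m p)\<^sup>T M (1 - m p)\<close> yields \<open>m Var X \<le> |V|\<close>.\<close>

section \<open>The least eigenvalue of a symmetric matrix\<close>

text \<open>Moving from \<open>x\<close> by \<open>t\<close> against \<open>f x\<close> changes the
  form from \<open>0\<close> to \<open>t^2 * c - 2 * t * a\<close>, where \<open>a\<close> is the
  squared norm of \<open>f x\<close>. For small positive \<open>t\<close> this is negative unless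
  \<open>a = 0\<close>.\<close>

lemma psd_kernel:
  fixes f :: "'a::euclidean_space \<Rightarrow> 'a"
  assumes "linear f" and sym: "\<And>x y. f x \<bullet> y = x \<bullet> f y"
    and psd: "\<And>x. 0 \<le> x \<bullet> f x" and "x \<bullet> f x = 0"
  shows "f x = 0"
proof -
  define y where "y = f x"
  define a where "a = y \<bullet> y"
  define c where "c = y \<bullet> f y"
  have c: "c \<ge> 0" and a: "a \<ge> 0"
    using psd by (auto simp: c_def a_def)
  \<comment> \<open>The quadratic in \<open>t\<close> is least at \<open>a / c\<close>; the
    \<open>+ 1\<close> covers \<open>c = 0\<close> and still gives a negative value unless
    \<open>a = 0\<close>.\<close>
  define t where "t = a / (c + 1)"
  have "0 \<le> (x - t *\<^sub>R y) \<bullet> f (x - t *\<^sub>R y)"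
    by (rule psd)
  also have "\<dots> = x \<bullet> f x - t * (x \<bullet> f y) - t * (y \<bullet> f x) + t * t * (y \<bullet> f y)"
    using \<open>linear f\<close> by (simp add: linear_diff linear_scale inner_diff_left inner_diff_right algebra_simps)
  also have "x \<bullet> f y = a"
    by (simp add: a_def y_def flip: sym)
  also have "y \<bullet> f x = a"
    by (simp add: a_def y_def)
  finally have "0 \<le> t * (t * c - 2 * a)"
    using assms(4) by (simp add: c_def algebra_simps)
  also have "t * c - 2 * a = - (a * (c + 2) / (c + 1))"
    using c by (simp add: t_def field_simps)
  finally have "a * a * (c + 2) / ((c + 1) * (c + 1)) \<le> 0"
    by (simp add: t_def)
  moreover have "(c + 2) / ((c + 1) * (c + 1)) > 0"
    using c by simp
  ultimately have "a * a \<le> 0"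
    by (metis mult.commute mult_le_0_iff not_le times_divide_eq_right)
  then have "a = 0"
    using a by (auto simp: mult_le_0_iff)
  then show ?thesis
    by (simp add: a_def y_def)
qed

text \<open>Let \<open>x\<close> minimise the form on the compact unit sphere, with value
  \<open>k\<close>. Then \<open>f - k Id\<close> is positive semidefinite and its form vanishes at
  \<open>x\<close>, so \<open>psd_kernel\<close> makes \<open>x\<close> an eigenvector.\<close>

lemma rayleigh_minimum:
  fixes f :: "'a::euclidean_space \<Rightarrow> 'a"
  assumes "linear f" and sym: "\<And>x y. f x \<bullet> y = x \<bullet> f y"
  obtains k x where "x \<noteq> 0" "f x = k *\<^sub>R x" "\<And>y. k * (y \<bullet> y) \<le> y \<bullet> f y"
proof -
  have "continuous_on (sphere 0 1) (\<lambda>x. x \<bullet> f x)"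
    by (intro continuous_intros linear_continuous_on linear_conv_bounded_linear[THEN iffD1] assms)
  moreover have "sphere (0::'a) 1 \<noteq> {}"
    by simp
  ultimately obtain x where x: "norm x = 1" and
    min: "\<And>y. norm y = 1 \<Longrightarrow> x \<bullet> f x \<le> y \<bullet> f y"
    using continuous_attains_inf[of "sphere (0::'a) 1" "\<lambda>x. x \<bullet> f x"] by auto
  define k where "k = x \<bullet> f x"
  have bound: "k * (y \<bullet> y) \<le> y \<bullet> f y" for y
  proof (cases "y = 0")
    case False
    define z where "z = y /\<^sub>R norm y"
    have "norm z = 1"
      using False by (simp add: z_def)
    have y: "y = norm y *\<^sub>R z"
      using False by (simp add: z_def)
    have "y \<bullet> f y = (norm y)\<^sup>2 * (z \<bullet> f z)"
      by (subst (1 2) y) (simp add: linear_scale[OF \<open>linear f\<close>] power2_eq_square)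
    moreover have "y \<bullet> y = (norm y)\<^sup>2"
      by (simp add: power2_norm_eq_inner)
    ultimately show ?thesis
      using min[OF \<open>norm z = 1\<close>] by (simp add: k_def mult.commute mult_right_mono)
  qed (simp add: linear_0 assms)
  have "f x - k *\<^sub>R x = 0"
  proof (rule psd_kernel[where f = "\<lambda>x. f x - k *\<^sub>R x"])
    show "linear (\<lambda>x. f x - k *\<^sub>R x)"
      by (intro linear_compose_sub linear_scaleR assms(1))
    show "(f x - k *\<^sub>R x) \<bullet> y = x \<bullet> (f y - k *\<^sub>R y)" for x y
      by (simp add: inner_diff_left inner_diff_right sym)
    show "0 \<le> y \<bullet> (f y - k *\<^sub>R y)" for y
      using bound[of y] by (simp add: inner_diff_right)
    show "x \<bullet> (f x - k *\<^sub>R x) = 0"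
      using x by (simp add: inner_diff_right k_def dot_square_norm)
  qed
  then have "f x = k *\<^sub>R x"
    by simp
  moreover have "x \<noteq> 0"
    using x by auto
  ultimately show thesis
    using that bound by blast
qed

lemma symmetric_matrix_inner:
  fixes A :: "real ^ 'n ^ 'n"
  assumes "transpose A = A"
  shows "(A *v x) \<bullet> y = x \<bullet> (A *v y)"
  by (metis assms dot_lmul_matrix vector_transpose_matrix)

text \<open>Makes \<open>Min\<close> in \<open>min_eigenvalue\<close> meaningful: eigenvectors of
  distinct eigenvalues are orthogonal, hence linearly independent.\<close>

lemma finite_eigenvalues_symmetric:
  fixes A :: "real ^ 'n ^ 'n"
  assumes "transpose A = A"
  shows "finite {k. is_eigenvalue A k}"
proof -
  define K where "K = {k. is_eigenvalue A k}"
  have "\<forall>k\<in>K. \<exists>x. x \<noteq> 0 \<and> A *v x = k *\<^sub>R x"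
    by (simp add: K_def is_eigenvalue_def)
  then obtain e where e: "\<And>k. k \<in> K \<Longrightarrow> e k \<noteq> 0" "\<And>k. k \<in> K \<Longrightarrow> A *v e k = k *\<^sub>R e k"
    by metis
  have orth: "e k \<bullet> e l = 0" if "k \<in> K" "l \<in> K" "k \<noteq> l" for k l
    using symmetric_matrix_inner[OF assms, of "e k" "e l"] e(2) that by simp
  have "inj_on e K"
    by (rule inj_onI) (metis orth e(1) inner_eq_zero_iff)
  moreover have "independent (e ` K)"
    using e(1) orth by (intro pairwise_orthogonal_independent)
      (auto simp: pairwise_def orthogonal_def)
  ultimately show ?thesis
    unfolding K_def[symmetric] by (meson finiteI_independent finite_imageD)
qed

lemma min_eigenvalue_le:
  fixes A :: "real ^ 'n ^ 'n"
  assumes "transpose A = A"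
  shows "min_eigenvalue A * (y \<bullet> y) \<le> y \<bullet> (A *v y)"
proof -
  obtain k x where "x \<noteq> 0" "A *v x = k *\<^sub>R x" and k: "\<And>y. k * (y \<bullet> y) \<le> y \<bullet> (A *v y)"
    using rayleigh_minimum[OF matrix_vector_mul_linear symmetric_matrix_inner[OF assms]] by metis
  then have "is_eigenvalue A k"
    by (auto simp: is_eigenvalue_def)
  then have "min_eigenvalue A \<le> k"
    unfolding min_eigenvalue_def by (intro Min_le finite_eigenvalues_symmetric assms) simp
  then have "min_eigenvalue A * (y \<bullet> y) \<le> k * (y \<bullet> y)"
    by (simp add: mult_right_mono)
  then show ?thesis
    using k order_trans by blast
qed

lemma adjacency_quadratic_form_ge:
  fixes E :: "'v::finite \<Rightarrow> 'v \<Rightarrow> bool" and x :: "'v \<Rightarrow> real"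
  assumes "simple_graph E"
  shows "min_eigenvalue (adjacency_matrix E) * (\<Sum>v\<in>UNIV. (x v)\<^sup>2)
    \<le> (\<Sum>v\<in>UNIV. \<Sum>w | E v w. x v * x w)"
proof -
  have "transpose (adjacency_matrix E) = adjacency_matrix E"
    using assms by (auto simp: transpose_def adjacency_matrix_def simple_graph_def symp_def vec_eq_iff)
  then have "min_eigenvalue (adjacency_matrix E) * ((\<chi> v. x v) \<bullet> (\<chi> v. x v))
    \<le> (\<chi> v. x v) \<bullet> (adjacency_matrix E *v (\<chi> v. x v))"
    by (rule min_eigenvalue_le)
  then show ?thesis
    by (simp add: inner_vec_def matrix_vector_mult_def adjacency_matrix_def power2_eq_square
        sum_distrib_left sum.If_cases if_distrib[of "\<lambda>t. t * _"] cong: if_cong)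
qed

text \<open>Finite-dimensional Fredholm alternative: the component \<open>z\<close> of
  \<open>y\<close> orthogonal to the range lies in the kernel, because the squared norm of
  \<open>f z\<close> is the inner product of \<open>z\<close> with \<open>f (f z)\<close>. Then
  \<open>orth\<close> forces \<open>z = 0\<close>.\<close>

lemma range_self_adjoint:
  fixes f :: "'a::euclidean_space \<Rightarrow> 'a"
  assumes "linear f" and sym: "\<And>x y. f x \<bullet> y = x \<bullet> f y"
    and orth: "\<And>z. f z = 0 \<Longrightarrow> y \<bullet> z = 0"
  shows "y \<in> range f"
proof -
  have span: "span (range f) = range f"
    using linear_subspace_image[OF \<open>linear f\<close> subspace_UNIV] by (simp add: span_eq_iff)
  obtain a z where a: "a \<in> range f" and z: "\<And>w. w \<in> range f \<Longrightarrow> z \<bullet> w = 0" and y: "y = a + z"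
    using orthogonal_subspace_decomp_exists[of "range f" y] unfolding span orthogonal_def by metis
  have "f z \<bullet> f z = 0"
    using z[of "f (f z)"] sym by simp
  then have "y \<bullet> z = 0"
    using orth by simp
  then have "z = 0"
    using z[OF a] y by (simp add: inner_add_left inner_add_right inner_commute)
  then show ?thesis
    using a y by simp
qed

section \<open>Glauber dynamics on a simplicial complex\<close>

definition ext :: "'a set set \<Rightarrow> 'a set \<Rightarrow> 'a set" where
  "ext F I = {w. w \<notin> I \<and> insert w I \<in> F}"

definition link :: "'a set set \<Rightarrow> 'a \<Rightarrow> 'a set set" where
  "link F v = {I \<in> F. v \<in> ext F I}"

definition diff :: "'a \<Rightarrow> ('a set \<Rightarrow> real) \<Rightarrow> 'a set \<Rightarrow> real" where
  "diff v h I = h (insert v I) - h I"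

definition gen :: "'a set set \<Rightarrow> real \<Rightarrow> ('a set \<Rightarrow> real) \<Rightarrow> 'a set \<Rightarrow> real" where
  "gen F c h I = (\<Sum>w\<in>ext F I. diff w h I) + (\<Sum>w\<in>I. h (I - {w}) - h I) / c"

text \<open>Each pair \<open>I\<close>, \<open>insert w I\<close> is counted once, at the smaller
  set. The weights stay unnormalised, so the same form serves \<open>F\<close> and all its
  links.\<close>

definition dirichlet :: "'a set set \<Rightarrow> real \<Rightarrow> ('a set \<Rightarrow> real) \<Rightarrow> ('a set \<Rightarrow> real) \<Rightarrow> real" where
  "dirichlet F c g h = (\<Sum>I\<in>F. c ^ card I * (\<Sum>w\<in>ext F I. diff w g I * diff w h I))"

definition down_closed :: "'a set set \<Rightarrow> bool" where
  "down_closed F \<longleftrightarrow> (\<forall>I\<in>F. \<forall>J. J \<subseteq> I \<longrightarrow> J \<in> F)"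

lemma down_closed_subset: "down_closed F \<Longrightarrow> I \<in> F \<Longrightarrow> J \<subseteq> I \<Longrightarrow> J \<in> F"
  by (auto simp: down_closed_def)

lemma down_closed_link:
  assumes "down_closed F"
  shows "down_closed (link F v)"
  unfolding down_closed_def
proof (intro ballI allI impI)
  fix I J assume "I \<in> link F v" "J \<subseteq> I"
  then show "J \<in> link F v"
    using down_closed_subset[OF assms, of I J] down_closed_subset[OF assms, of "insert v I" "insert v J"]
    by (auto simp: link_def ext_def)
qed

text \<open>Both sides run over the same pairs of sets differing in one vertex, indexed by the
  larger set on the left and by the smaller one on the right; the two weights differ by a factor
  \<open>c\<close>.\<close>

lemma detailed_balance:
  fixes F :: "'a::finite set set" and c :: real
  assumes "down_closed F"
  shows "(\<Sum>I\<in>F. c ^ card I * (\<Sum>w\<in>I. \<Phi> (I - {w}) w))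
    = c * (\<Sum>I\<in>F. c ^ card I * (\<Sum>w\<in>ext F I. \<Phi> I w))" (is "?l = ?r")
proof -
  have "?l = (\<Sum>(I, w)\<in>(SIGMA I:F. I). c ^ card I * \<Phi> (I - {w}) w)"
    unfolding sum_distrib_left by (subst sum.Sigma) auto
  also have "\<dots> = (\<Sum>(I, w)\<in>(SIGMA I:F. ext F I). c * (c ^ card I * \<Phi> I w))"
  proof -
    have "c ^ card I = c * c ^ card (I - {w})" if "w \<in> I" for w :: 'a and I
      using that by (subst card.remove[of I w]) auto
    then show ?thesis
      by (intro sum.reindex_bij_witness[where i = "\<lambda>(I, w). (insert w I, w)"
            and j = "\<lambda>(I, w). (I - {w}, w)"])
        (auto simp: ext_def insert_absorb intro: down_closed_subset[OF assms])
  qed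
  also have "\<dots> = ?r"
    unfolding sum_distrib_left by (subst sum.Sigma) auto
  finally show ?thesis .
qed

text \<open>Summation by parts: carried to the smaller set, the removal terms supply the
  \<open>g (insert w I)\<close> half of \<open>diff w g I\<close>, and the removal rate
  \<open>1 / c\<close> cancels the factor from \<open>detailed_balance\<close>.\<close>

lemma sum_gen_eq_dirichlet:
  fixes F :: "'a::finite set set"
  assumes "down_closed F" "c > 0"
  shows "(\<Sum>I\<in>F. c ^ card I * (g I * gen F c h I)) = - dirichlet F c g h"
proof -
  have "(\<Sum>I\<in>F. c ^ card I * (\<Sum>w\<in>I. g I * (h (I - {w}) - h I)))
    = (\<Sum>I\<in>F. c ^ card I * (\<Sum>w\<in>I. - (g (insert w (I - {w})) * diff w h (I - {w}))))"
    by (intro sum.cong refl arg_cong2[where f = "(*)"]) (auto simp: diff_def insert_absorb algebra_simps)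
  also have "\<dots> = c * (\<Sum>I\<in>F. c ^ card I * (\<Sum>w\<in>ext F I. - (g (insert w I) * diff w h I)))"
    using detailed_balance[OF assms(1), where \<Phi> = "\<lambda>I w. - (g (insert w I) * diff w h I)"] .
  finally have *: "(\<Sum>I\<in>F. c ^ card I * (\<Sum>w\<in>I. g I * (h (I - {w}) - h I))) / c
    = (\<Sum>I\<in>F. c ^ card I * (\<Sum>w\<in>ext F I. - (g (insert w I) * diff w h I)))"
    using assms(2) by simp
  have "(\<Sum>I\<in>F. c ^ card I * (g I * gen F c h I))
    = (\<Sum>I\<in>F. c ^ card I * (\<Sum>w\<in>ext F I. g I * diff w h I))
      + (\<Sum>I\<in>F. c ^ card I * (\<Sum>w\<in>I. g I * (h (I - {w}) - h I))) / c"
    by (simp add: gen_def sum_divide_distrib sum_distrib_left algebra_simps flip: sum.distrib)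
  also have "\<dots> = - dirichlet F c g h"
    unfolding * dirichlet_def diff_def[of _ g]
    by (simp add: algebra_simps sum_subtractf sum_negf sum.distrib)
  finally show ?thesis .
qed

lemma dirichlet_commute: "dirichlet F c g h = dirichlet F c h g"
  by (simp add: dirichlet_def mult.commute)

lemma dirichlet_nonneg: "c > 0 \<Longrightarrow> 0 \<le> dirichlet F c h h"
  unfolding dirichlet_def by (intro sum_nonneg mult_nonneg_nonneg zero_le_square) auto

text \<open>Irreducibility: every member of \<open>F\<close> is built from the empty set by adding
  vertices within \<open>F\<close>, and no such addition changes \<open>h\<close>.\<close>

lemma dirichlet_eq_0_imp_constant:
  fixes F :: "'a::finite set set"
  assumes "down_closed F" "c > 0" "dirichlet F c h h = 0" "I \<in> F"
  shows "h I = h {}"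
proof -
  have "0 \<le> c ^ card I * (\<Sum>w\<in>ext F I. diff w h I * diff w h I)" for I
    using assms(2) by (intro mult_nonneg_nonneg sum_nonneg zero_le_square) simp
  then have "\<forall>I\<in>F. c ^ card I * (\<Sum>w\<in>ext F I. diff w h I * diff w h I) = 0"
    using assms(3) unfolding dirichlet_def by (subst (asm) sum_nonneg_eq_0_iff) simp_all
  then have zero: "diff w h I = 0" if "I \<in> F" "w \<in> ext F I" for I w
    using assms(2) that by (simp add: sum_nonneg_eq_0_iff)
  have "finite I"
    by simp
  from this \<open>I \<in> F\<close> show ?thesis
  proof induction
    case (insert w J)
    have "J \<in> F"
      using down_closed_subset[OF assms(1) insert.prems] by blast
    then show ?case
      using zero[of J w] insert by (auto simp: diff_def ext_def)
  qed simp
qed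

text \<open>By the Fredholm alternative it suffices that the centred right-hand side is orthogonal
  to the kernel, whose elements are constant on \<open>F\<close>.\<close>

lemma poisson_equation:
  fixes F :: "'a::finite set set" and g :: "'a set \<Rightarrow> real"
  assumes "down_closed F" "c > 0" and mean: "(\<Sum>I\<in>F. c ^ card I * g I) = 0"
  obtains h where "\<And>I. I \<in> F \<Longrightarrow> gen F c h I = g I"
proof -
  \<comment> \<open>The factor \<open>c ^ card I\<close> makes the generator self-adjoint for the
    standard inner product; coordinates outside \<open>F\<close> are sent to
    \<open>0\<close>.\<close>
  define f :: "real ^ 'a set \<Rightarrow> real ^ 'a set" where
    "f x = (\<chi> I. if I \<in> F then c ^ card I * gen F c (($) x) I else 0)" for x
  have "linear f"
    by (rule linearI) (auto simp: f_def vec_eq_iff gen_def diff_def sum_distrib_left algebra_simps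
        sum_subtractf sum.distrib add_divide_distrib diff_divide_distrib)
  have inner: "x \<bullet> f y = - dirichlet F c (($) x) (($) y)" for x y
    using sum_gen_eq_dirichlet[OF assms(1,2), of "($) x" "($) y"]
    by (simp add: f_def inner_vec_def if_distrib[of "\<lambda>t. _ * t"] sum.If_cases algebra_simps cong: if_cong)
  define y :: "real ^ 'a set" where "y = (\<chi> I. if I \<in> F then c ^ card I * g I else 0)"
  have "y \<in> range f"
  proof (rule range_self_adjoint[OF \<open>linear f\<close>])
    show "f x \<bullet> z = x \<bullet> f z" for x z
      by (metis inner inner_commute dirichlet_commute)
    show "y \<bullet> z = 0" if "f z = 0" for z
    proof -
      have "dirichlet F c (($) z) (($) z) = 0"
        using inner[of z z] that by simp
      then have const: "z $ I = z $ {}" if "I \<in> F" for I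
        using dirichlet_eq_0_imp_constant[OF assms(1,2)] that by blast
      have "y \<bullet> z = (\<Sum>I\<in>F. c ^ card I * g I * z $ I)"
        by (simp add: y_def inner_vec_def if_distrib[of "\<lambda>t. t * _"] sum.If_cases cong: if_cong)
      also have "\<dots> = (\<Sum>I\<in>F. c ^ card I * g I * z $ {})"
        by (intro sum.cong refl) (metis const)
      also have "\<dots> = 0"
        using mean by (simp flip: sum_distrib_right)
      finally show ?thesis .
    qed
  qed
  then obtain x where x: "y = f x"
    by blast
  have "gen F c (($) x) I = g I" if "I \<in> F" for I
    using x that assms(2) by (simp add: vec_eq_iff f_def y_def) (metis mult_left_cancel power_not_zero less_irrefl)
  then show thesis
    using that by blast
qed

section \<open>Bochner's inequality for the hard-core model\<close>

lemma down_closed_independent_sets: "down_closed (independent_sets E)"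
  by (auto simp: down_closed_def independent_sets_def)

text \<open>Once \<open>v\<close> is added, exactly the neighbours of \<open>v\<close>, and
  \<open>v\<close> itself, stop being admissible. The remaining moves are those of the dynamics on the link.\<close>

lemma gen_commutator:
  fixes E :: "'v::finite \<Rightarrow> 'v \<Rightarrow> bool"
  defines "F \<equiv> independent_sets E"
  assumes E: "simple_graph E" and "I \<in> F" and v: "v \<in> ext F I"
  shows "diff v (gen F c h) I = gen (link F v) c (diff v h) I - (1 + 1 / c) * diff v h I
    - (\<Sum>w\<in>{w\<in>ext F I. E v w}. diff w h I)"
proof -
  have vI: "v \<notin> I" and vF: "insert v I \<in> F"
    using v by (auto simp: ext_def)
  have sym: "E x y \<longleftrightarrow> E y x" and irr: "\<not> E x x" for x y
    using E by (auto simp: simple_graph_def symp_def irreflp_def)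
  have ext1: "ext F (insert v I) = ext (link F v) I"
  proof -
    have "insert w I \<in> F" if "insert w (insert v I) \<in> F" for w
      by (rule down_closed_subset[OF down_closed_independent_sets[of E, folded F_def] that]) auto
    then show ?thesis
      using vI vF \<open>I \<in> F\<close> by (auto simp: ext_def link_def insert_commute)
  qed
  have ext2: "ext F I = insert v ({w\<in>ext F I. E v w} \<union> ext (link F v) I)"
    using v vI sym irr by (auto simp: ext_def link_def F_def independent_sets_def)
  have disj: "{w\<in>ext F I. E v w} \<inter> ext (link F v) I = {}" "v \<notin> ext (link F v) I"
    using vI sym by (auto simp: ext_def link_def F_def independent_sets_def)
  \<comment> \<open>The separate summand for \<open>v\<close> accounts for the \<open>1\<close> in
    \<open>1 + 1 / c\<close>.\<close>
  have "(\<Sum>w\<in>ext F I. diff w h I) = diff v h I + (\<Sum>w\<in>{w\<in>ext F I. E v w}. diff w h I)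
    + (\<Sum>w\<in>ext (link F v) I. diff w h I)"
    by (subst ext2, subst sum.insert) (use disj irr in \<open>auto simp: sum.union_disjoint\<close>)
  \<comment> \<open>Removing \<open>v\<close> itself leads back to \<open>I\<close>; this extra move
    accounts for the \<open>1 / c\<close>.\<close>
  moreover have "(\<Sum>w\<in>insert v I. h (insert v I - {w}) - h (insert v I)) / c
    = (\<Sum>w\<in>I. diff v h (I - {w}) - diff v h I) / c + (\<Sum>w\<in>I. h (I - {w}) - h I) / c
      - diff v h I / c"
  proof -
    have "insert v I - {w} = insert v (I - {w})" if "w \<in> I" for w
      using that vI by auto
    then have "(\<Sum>w\<in>insert v I. h (insert v I - {w}) - h (insert v I))
      = (\<Sum>w\<in>I. h (insert v (I - {w})) - h (insert v I)) - diff v h I"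
      using vI by (simp add: diff_def)
    also have "(\<Sum>w\<in>I. h (insert v (I - {w})) - h (insert v I))
      = (\<Sum>w\<in>I. diff v h (I - {w}) - diff v h I) + (\<Sum>w\<in>I. h (I - {w}) - h I)"
      by (simp add: diff_def flip: sum.distrib)
    finally show ?thesis
      by (simp add: add_divide_distrib diff_divide_distrib)
  qed
  moreover have "(\<Sum>w\<in>ext (link F v) I. diff w h (insert v I))
    = (\<Sum>w\<in>ext (link F v) I. diff w (diff v h) I) + (\<Sum>w\<in>ext (link F v) I. diff w h I)"
    by (simp add: diff_def insert_commute flip: sum.distrib)
  ultimately show ?thesis
    by (simp add: diff_def[of v "gen F c h"] gen_def ext1 add_divide_distrib algebra_simps)
qed

lemma bochner_inequality:
  fixes E :: "'v::finite \<Rightarrow> 'v \<Rightarrow> bool"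
  defines "F \<equiv> independent_sets E"
  assumes E: "simple_graph E" and c: "c > 0"
  shows "(\<Sum>I\<in>F. c ^ card I * (\<Sum>v\<in>ext F I. (1 + 1 / c) * (diff v h I)\<^sup>2
      + (\<Sum>w\<in>{w\<in>ext F I. E v w}. diff v h I * diff w h I)))
    \<le> (\<Sum>I\<in>F. c ^ card I * (gen F c h I)\<^sup>2)"
proof -
  note dc = down_closed_independent_sets[of E, folded F_def]
  define Q where "Q v I = (1 + 1 / c) * (diff v h I)\<^sup>2
      + (\<Sum>w\<in>{w\<in>ext F I. E v w}. diff v h I * diff w h I)" for v I
  define R where "R v I = diff v h I * gen (link F v) c (diff v h) I" for v I
  have "diff v (gen F c h) I * diff v h I = R v I - Q v I" if "I \<in> F" "v \<in> ext F I" for I v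
    using gen_commutator[of E I v c h, folded F_def, OF E that]
    unfolding R_def Q_def power2_eq_square sum_distrib_left[symmetric]
    by (simp add: left_diff_distrib distrib_right right_diff_distrib distrib_left mult.commute mult.left_commute)
  then have "- dirichlet F c (gen F c h) h
    = (\<Sum>I\<in>F. c ^ card I * (\<Sum>v\<in>ext F I. Q v I)) - (\<Sum>I\<in>F. c ^ card I * (\<Sum>v\<in>ext F I. R v I))"
    by (simp add: dirichlet_def sum_subtractf right_diff_distrib)
  moreover have "(\<Sum>I\<in>F. c ^ card I * (\<Sum>v\<in>ext F I. R v I)) \<le> 0"
  proof -
    have "(\<Sum>I\<in>F. c ^ card I * (\<Sum>v\<in>ext F I. R v I))
      = (\<Sum>I\<in>F. \<Sum>v | v \<in> ext F I. c ^ card I * R v I)"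
      by (simp add: sum_distrib_left)
    \<comment> \<open>For fixed \<open>v\<close> the sum runs exactly over \<open>link F v\<close>,
      where summation by parts applies to \<open>diff v h\<close>.\<close>
    also have "\<dots> = (\<Sum>v\<in>UNIV. \<Sum>I\<in>link F v. c ^ card I * R v I)"
      using sum.swap_restrict[of F UNIV "\<lambda>I v. c ^ card I * R v I" "\<lambda>I v. v \<in> ext F I"]
      by (simp add: link_def)
    also have "\<dots> = (\<Sum>v\<in>UNIV. - dirichlet (link F v) c (diff v h) (diff v h))"
      unfolding R_def by (simp add: sum_gen_eq_dirichlet[OF down_closed_link[OF dc] c])
    also have "\<dots> \<le> 0"
      by (intro sum_nonpos) (simp add: dirichlet_nonneg[OF c])
    finally show ?thesis .
  qed
  ultimately show ?thesis
    using sum_gen_eq_dirichlet[OF dc c, of "gen F c h" h] by (simp add: Q_def power2_eq_square)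
qed

section \<open>The variance bound\<close>

lemma regular_quadratic_form:
  fixes E :: "'v::finite \<Rightarrow> 'v \<Rightarrow> bool" and p :: "'v \<Rightarrow> real"
  assumes E: "simple_graph E" and reg: "regular_graph d E"
    and lam: "k \<ge> - min_eigenvalue (adjacency_matrix E)"
  defines "m \<equiv> real d + k"
  shows "2 * m\<^sup>2 * (\<Sum>v\<in>UNIV. p v)
    \<le> real CARD('v) * m + m\<^sup>2 * (\<Sum>v\<in>UNIV. k * (p v)\<^sup>2 + (\<Sum>w | E v w. p v * p w))"
proof -
  have sym: "E x y \<longleftrightarrow> E y x" for x y
    using E by (auto simp: simple_graph_def symp_def)
  have deg: "real (card {w. E v w}) = d" for v
    using reg by (simp add: regular_graph_def)
  define x where "x v = 1 - m * p v" for v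
  have "0 \<le> (k + min_eigenvalue (adjacency_matrix E)) * (\<Sum>v\<in>UNIV. (x v)\<^sup>2)"
    using lam by (intro mult_nonneg_nonneg sum_nonneg) auto
  then have "0 \<le> k * (\<Sum>v\<in>UNIV. (x v)\<^sup>2) + (\<Sum>v\<in>UNIV. \<Sum>w | E v w. x v * x w)"
    using adjacency_quadratic_form_ge[OF E, of x] by (simp add: distrib_right)
  also have "(\<Sum>v\<in>UNIV. (x v)\<^sup>2) = (\<Sum>v\<in>UNIV. 1 - 2 * m * p v + m\<^sup>2 * (p v)\<^sup>2)"
    by (simp add: x_def power2_eq_square algebra_simps)
  also have "\<dots> = real CARD('v) - 2 * m * (\<Sum>v\<in>UNIV. p v) + m\<^sup>2 * (\<Sum>v\<in>UNIV. (p v)\<^sup>2)"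
    by (simp add: sum.distrib sum_subtractf sum_distrib_left)
  also have "(\<Sum>v\<in>UNIV. \<Sum>w | E v w. x v * x w)
      = (\<Sum>v\<in>UNIV. \<Sum>w | E v w. 1 - m * p v - m * p w + m\<^sup>2 * (p v * p w))"
    by (simp add: x_def power2_eq_square algebra_simps)
  also have "\<dots> = real CARD('v) * d - m * d * (\<Sum>v\<in>UNIV. p v) - m * (\<Sum>v\<in>UNIV. \<Sum>w | E v w. p w)
      + m\<^sup>2 * (\<Sum>v\<in>UNIV. \<Sum>w | E v w. p v * p w)"
    by (simp add: sum.distrib sum_subtractf deg right_diff_distrib sum_distrib_left mult.assoc mult.left_commute)
  \<comment> \<open>Double counting: each \<open>p w\<close> occurs once for each of the
    \<open>d\<close> neighbours of \<open>w\<close>.\<close>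
  also have "(\<Sum>v\<in>UNIV. \<Sum>w | E v w. p w) = d * (\<Sum>v\<in>UNIV. p v)"
  proof -
    have "(\<Sum>v\<in>UNIV. \<Sum>w | E v w. p w) = (\<Sum>w\<in>UNIV. \<Sum>v | E v w. p w)"
      using sum.swap_restrict[of UNIV UNIV "\<lambda>v w. p w" E] by simp
    also have "\<dots> = (\<Sum>w\<in>UNIV. d * p w)"
      by (subst sym) (simp add: deg)
    finally show ?thesis
      by (simp add: sum_distrib_left)
  qed
  finally have *: "0 \<le> k * (real CARD('v) - 2 * m * (\<Sum>v\<in>UNIV. p v) + m\<^sup>2 * (\<Sum>v\<in>UNIV. (p v)\<^sup>2))
      + (real CARD('v) * d - m * d * (\<Sum>v\<in>UNIV. p v) - m * (d * (\<Sum>v\<in>UNIV. p v))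
      + m\<^sup>2 * (\<Sum>v\<in>UNIV. \<Sum>w | E v w. p v * p w))" .
  \<comment> \<open>With the sums replaced by real variables, only a polynomial identity in
    \<open>m = d + k\<close> remains.\<close>
  have "2 * m\<^sup>2 * s \<le> n * m + m\<^sup>2 * (k * a + b)"
    if "0 \<le> k * (n - 2 * m * s + m\<^sup>2 * a) + (n * d - m * d * s - m * (d * s) + m\<^sup>2 * b)"
    for n s a b :: real
  proof -
    have "k * (n - 2 * m * s + m\<^sup>2 * a) + (n * d - m * d * s - m * (d * s) + m\<^sup>2 * b)
      = n * m - 2 * m\<^sup>2 * s + m\<^sup>2 * (k * a + b)"
      by (simp add: m_def power2_eq_square algebra_simps)
    then show ?thesis
      using that by linarith
  qed
  from this[OF *] show ?thesis
    by (simp only: sum.distrib sum_distrib_left)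
qed

text \<open>The variance bound multiplied through by the partition function; \<open>mean\<close>
  says that \<mu> is the expected size.\<close>

lemma hardcore_sum_squares_le:
  fixes E :: "'v::finite \<Rightarrow> 'v \<Rightarrow> bool"
  defines "F \<equiv> independent_sets E"
  assumes E: "simple_graph E" and reg: "regular_graph d E" and c: "c > 0"
    and lam: "1 + 1 / c \<ge> - min_eigenvalue (adjacency_matrix E)"
    and mean: "(\<Sum>I\<in>F. c ^ card I * (real (card I) - \<mu>)) = 0"
  shows "(real d + 1 + 1 / c) * (\<Sum>I\<in>F. c ^ card I * (real (card I) - \<mu>)\<^sup>2)
    \<le> real CARD('v) * partition_function E c"
proof -
  note dc = down_closed_independent_sets[of E, folded F_def]
  define m where "m = real d + (1 + 1 / c)"
  have m: "m > 0"
    using c by (simp add: m_def add_nonneg_pos)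
  define V where "V = (\<Sum>I\<in>F. c ^ card I * (real (card I) - \<mu>)\<^sup>2)"
  have "(\<Sum>I\<in>F. c ^ card I * - (real (card I) - \<mu>)) = 0"
    using mean by (simp only: mult_minus_right sum_negf)
  \<comment> \<open>The minus sign offsets the one in \<open>sum_gen_eq_dirichlet\<close>, so
    pairing \<open>h\<close> with the centred size gives \<open>+ V\<close>.\<close>
  then obtain h where h: "\<And>I. I \<in> F \<Longrightarrow> gen F c h I = - (real (card I) - \<mu>)"
    using poisson_equation[OF dc c] by metis
  \<comment> \<open>Extension by zero lets the quadratic form of the whole graph be applied at every
    \<open>I\<close>, although only some vertices are admissible there.\<close>
  define p where "p I v = (if v \<in> ext F I then diff v h I else 0)" for I v
  define q where "q I = (\<Sum>v\<in>UNIV. (1 + 1 / c) * (p I v)\<^sup>2 + (\<Sum>w | E v w. p I v * p I w))" for I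
  \<comment> \<open>Adding a vertex raises the size by exactly \<open>1\<close>, so the Dirichlet
    form against the size is a plain sum of increments of \<open>h\<close>.\<close>
  have "(\<Sum>I\<in>F. c ^ card I * (\<Sum>v\<in>UNIV. p I v)) = dirichlet F c (\<lambda>I. real (card I) - \<mu>) h"
  proof -
    have "diff v (\<lambda>I. real (card I) - \<mu>) I = 1" if "v \<in> ext F I" for v I
      using that by (simp add: diff_def ext_def)
    then show ?thesis
      by (simp add: dirichlet_def p_def sum.If_cases)
  qed
  also have "\<dots> = V"
    using sum_gen_eq_dirichlet[OF dc c, of "\<lambda>I. real (card I) - \<mu>" h]
    by (simp add: h V_def power2_eq_square sum_negf del: minus_diff_eq cong: sum.cong)
  finally have 1: "(\<Sum>I\<in>F. c ^ card I * (\<Sum>v\<in>UNIV. p I v)) = V" .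
  have "q I = (\<Sum>v\<in>ext F I. (1 + 1 / c) * (diff v h I)\<^sup>2
      + (\<Sum>w\<in>{w\<in>ext F I. E v w}. diff v h I * diff w h I))" for I
  proof -
    have "(\<Sum>w | E v w. p I v * p I w) = (\<Sum>w\<in>{w\<in>ext F I. E v w}. diff v h I * diff w h I)"
      if "v \<in> ext F I" for v
      using that by (intro sum.mono_neutral_cong_right) (auto simp: p_def)
    then show ?thesis
      unfolding q_def by (intro sum.mono_neutral_cong_right) (auto simp: p_def)
  qed
  then have "(\<Sum>I\<in>F. c ^ card I * q I) \<le> (\<Sum>I\<in>F. c ^ card I * (gen F c h I)\<^sup>2)"
    using bochner_inequality[OF E c, of h, folded F_def] by simp
  also have "\<dots> = V"
    unfolding V_def by (intro sum.cong refl) (simp add: h power2_commute)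
  finally have 2: "(\<Sum>I\<in>F. c ^ card I * q I) \<le> V" .
  \<comment> \<open>The left side equals \<open>2 * m^2 * V\<close>, while Bochner puts at most
    \<open>m^2 * V\<close> on the right; the surplus \<open>m^2 * V\<close> yields the
    bound.\<close>
  have "(\<Sum>I\<in>F. c ^ card I * (2 * m\<^sup>2 * (\<Sum>v\<in>UNIV. p I v)))
    \<le> (\<Sum>I\<in>F. c ^ card I * (real CARD('v) * m + m\<^sup>2 * q I))"
    unfolding q_def m_def using c
    by (intro sum_mono mult_left_mono regular_quadratic_form[OF E reg lam]) auto
  also have "\<dots> = real CARD('v) * m * partition_function E c + m\<^sup>2 * (\<Sum>I\<in>F. c ^ card I * q I)"
    by (simp add: partition_function_def F_def sum.distrib sum_distrib_left algebra_simps)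
  also have "\<dots> \<le> real CARD('v) * m * partition_function E c + m\<^sup>2 * V"
    using 2 by (simp add: mult_left_mono)
  also have "(\<Sum>I\<in>F. c ^ card I * (2 * m\<^sup>2 * (\<Sum>v\<in>UNIV. p I v))) = 2 * m\<^sup>2 * V"
    unfolding 1[symmetric] by (simp add: sum_distrib_left algebra_simps)
  finally have "m * (m * V) \<le> m * (real CARD('v) * partition_function E c)"
    by (simp add: power2_eq_square algebra_simps)
  then show ?thesis
    using m by (simp add: m_def V_def add.assoc)
qed

lemma hardcore_expectation:
  fixes E :: "'v::finite \<Rightarrow> 'v \<Rightarrow> bool" and f :: "'v set \<Rightarrow> real"
  assumes "c > 0"
  shows "measure_pmf.expectation (hardcore E c) f
    = (\<Sum>I\<in>independent_sets E. c ^ card I * f I) / partition_function E c"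
  using assms by (simp add: integral_measure_pmf[of UNIV] pmf_hardcore if_distrib[of "\<lambda>t. t * _"]
      sum.If_cases sum_divide_distrib cong: if_cong)

theorem theorem3p20:
  fixes E :: "'v::finite \<Rightarrow> 'v \<Rightarrow> bool" and \<Delta> :: nat and fug lstar :: real
  assumes "simple_graph E"
    and "regular_graph \<Delta> E"
    and "lstar = - min_eigenvalue (adjacency_matrix E)"
    and "fug > 0"
    and "1 + inverse fug \<ge> lstar"
  shows "variance_fraction E fug \<le> fug / (1 + (real \<Delta> + 1) * fug)"
proof -
  define Z where "Z = partition_function E fug"
  have Z: "Z > 0"
    using partition_function_pos[OF assms(4)] by (simp add: Z_def)
  define \<mu> where "\<mu> = measure_pmf.expectation (hardcore E fug) (\<lambda>I. real (card I))"
  define V where "V = (\<Sum>I\<in>independent_sets E. fug ^ card I * (real (card I) - \<mu>)\<^sup>2)"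
  define m where "m = real \<Delta> + 1 + 1 / fug"
  have m: "m > 0"
    using assms(4) by (simp add: m_def add_nonneg_pos)
  have "(\<Sum>I\<in>independent_sets E. fug ^ card I * real (card I)) = \<mu> * Z"
    unfolding \<mu>_def hardcore_expectation[OF assms(4)] using Z by (simp add: Z_def)
  then have "(\<Sum>I\<in>independent_sets E. fug ^ card I * (real (card I) - \<mu>)) = 0"
    by (simp add: Z_def partition_function_def algebra_simps sum_subtractf sum_distrib_left)
  then have "m * V \<le> real CARD('v) * Z"
    unfolding m_def V_def Z_def using assms
    by (intro hardcore_sum_squares_le) (auto simp: inverse_eq_divide)
  then have "V / Z / real CARD('v) \<le> 1 / m"
    using Z m by (simp add: field_simps)
  moreover have "variance_fraction E fug = V / Z / real CARD('v)"
    unfolding variance_fraction_def \<mu>_def[symmetric] V_def Z_def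
    by (subst hardcore_expectation[OF assms(4)]) (rule refl)
  moreover have "1 / m = fug / (1 + (real \<Delta> + 1) * fug)"
    using assms(4) by (simp add: m_def field_simps)
  ultimately show ?thesis
    by simp
qed

end
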